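(* Let $\varphi(z)=\sum_{k=1}^{\infty}\alpha_kz^k$ and $\psi(z)=\sum_{k=0}^{\infty}\beta_kz^k$ be holomorphic in the open unit disk $\mathbb{D}$ with $\alpha_1\neq0$, $\beta_0\neq0$. Put $b:=\frac{1}{\alpha_1\beta_0}$, $\widetilde{\alpha}:=2\alpha_2^2-\alpha_1\alpha_3$ and $\widetilde{\beta}:=2\beta_1^2-\beta_0\beta_2$. Let $G\in\mathcal{B}_{\varphi,\psi}$, $G(z)=\sum_{k=1}^{\infty}b_kz^k$. The following assertions hold. (I) If $\beta_1=\psi'(0)\neq0$, then the coefficient $b_3$ lies in the closed disk $\overline{D_{\rho_1}(c_1)}$, where $$c_1=b^5\left[\beta_0^2\widetilde{\alpha}+3\alpha_1\beta_0\alpha_2\beta_1\gamma_1+\alpha_1^2\widetilde{\beta}\gamma_1^2\right]\quad\text{and}\quad \rho_1=|b|^4|\alpha_1\beta_1|\left(1-|\gamma_1|^2\right)$$ for some $\gamma_1\in\overline{\mathbb{D}}$. (II) If $\beta_1=0$, then $b_3$ lies in the closed disk $\overline{D_{\rho_2}(c_2)}$, where $$c_2=b^5\beta_0^2\widetilde{\alpha}\quad\text{and}\quad\rho_2=|b|^4\left|\alpha_1\beta_2\right|.$$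
   Context: $\mathcal{A}_{\varphi,\psi}$ is the class of functions $F$ holomorphic in $\mathbb{D}$ of the form $F(z)=\varphi(z)\psi(\omega(z))$, $z\in\mathbb{D}$, for some holomorphic self-mapping $\omega$ of $\mathbb{D}$ with $\omega(0)=0$. Since $F(0)=0$ and $F'(0)=\alpha_1\beta_0\neq0$, $F$ has a local inverse $F^{-1}$ near zero with $F^{-1}(0)=0$, and $\mathcal{B}_{\varphi,\psi}:=\{F^{-1}:F\in\mathcal{A}_{\varphi,\psi}\}$. $D_\rho(c)$ denotes the open disk of radius $\rho$ centered at $c$; $\overline{D_\rho(c)}=\{z:|z-c|\le\rho\}$, which is the single point $c$ if $\rho=0$. *)

theory Defs
  imports "HOL-Complex_Analysis.Complex_Analysis"
begin

text \<open>Values of functions outside the unit disk \<open>ball 0 1\<close> are irrelevant.\<close>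

definition class_A :: "(complex \<Rightarrow> complex) \<Rightarrow> (complex \<Rightarrow> complex) \<Rightarrow> (complex \<Rightarrow> complex) set" where
  "class_A \<phi> \<psi> = {F. F holomorphic_on ball 0 1 \<and>
     (\<exists>\<omega>. \<omega> holomorphic_on ball 0 1 \<and> \<omega> ` ball 0 1 \<subseteq> ball 0 1 \<and> \<omega> 0 = 0 \<and>
          (\<forall>z\<in>ball 0 1. F z = \<phi> z * \<psi> (\<omega> z)))}"

text \<open>The local inverse \<open>F\<^sup>-\<^sup>1\<close> is determined only as a germ at \<open>0\<close>: \<open>G\<close> is a local inverse
  if it inverts \<open>F\<close> on some neighbourhoods of \<open>0\<close>.\<close>

definition local_inverse_at_0 :: "(complex \<Rightarrow> complex) \<Rightarrow> (complex \<Rightarrow> complex) \<Rightarrow> bool" where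
  "local_inverse_at_0 F G \<longleftrightarrow> G 0 = 0 \<and>
     (\<exists>U V. open U \<and> open V \<and> 0 \<in> U \<and> 0 \<in> V \<and> U \<subseteq> ball 0 1 \<and> G holomorphic_on V \<and>
        (\<forall>z\<in>U. F z \<in> V \<and> G (F z) = z) \<and>
        (\<forall>w\<in>V. G w \<in> U \<and> F (G w) = w))"

definition class_B :: "(complex \<Rightarrow> complex) \<Rightarrow> (complex \<Rightarrow> complex) \<Rightarrow> (complex \<Rightarrow> complex) set" where
  "class_B \<phi> \<psi> = {G. \<exists>F\<in>class_A \<phi> \<psi>. local_inverse_at_0 F G}"

end

theory Submission
  imports Defs
begin

text \<open>Write \<open>F(z) = \<phi>(z) \<psi>(\<omega>(z))\<close> with \<open>\<omega>(z) = c\<^sub>1 z + c\<^sub>2 z\<^sup>2 + \<dots>\<close>, and let \<open>a\<^sub>k\<close> be the Taylor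
  coefficients of \<open>F\<close>. Comparing coefficients in \<open>F (G(z)) = z\<close> gives
  \<open>b\<^sub>3 = (2 a\<^sub>2\<^sup>2 - a\<^sub>1 a\<^sub>3) / a\<^sub>1\<^sup>5\<close> (lemma \<open>fps_right_inverse_nth_3\<close>). Among \<open>a\<^sub>1, a\<^sub>2, a\<^sub>3\<close> only \<open>a\<^sub>3\<close>
  involves \<open>c\<^sub>2\<close>, and it does so linearly. Hence \<open>b\<^sub>3 = C - b\<^sup>4 \<alpha>\<^sub>1 \<beta>\<^sub>1 c\<^sub>2\<close>, where \<open>C\<close> is the centre of the
  disk in the first assertion, taken at \<open>\<gamma>\<^sub>1 = c\<^sub>1\<close>.

  The self-maps \<open>\<omega>\<close> of the disk that fix the origin satisfy \<open>\<bar>c\<^sub>1\<bar> \<le> 1\<close> and \<open>\<bar>c\<^sub>2\<bar> \<le> 1 - \<bar>c\<^sub>1\<bar>\<^sup>2\<close>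
  (lemma \<open>Schwarz_second_coefficient\<close>); the second bound is the Schwarz--Pick inequality at the
  origin for \<open>\<omega>(z) / z\<close>. So \<open>\<gamma>\<^sub>1 = c\<^sub>1\<close> is the parameter wanted in the first assertion. If
  \<open>\<beta>\<^sub>1 = 0\<close>, then the terms that remain besides \<open>b\<^sup>5 \<beta>\<^sub>0\<^sup>2 \<alpha>t\<close> collapse to \<open>- b\<^sup>4 \<alpha>\<^sub>1 \<beta>\<^sub>2 c\<^sub>1\<^sup>2\<close>,
  and the bound \<open>\<bar>c\<^sub>1\<bar> \<le> 1\<close> alone gives the second assertion.\<close>

text \<open>A Moebius transformation of the disk moves \<open>h 0\<close> to the origin, where Schwarz's lemma applies;
  its derivative at \<open>h 0\<close> is \<open>1 / (1 - \<bar>h 0\<bar>\<^sup>2)\<close>.\<close>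

lemma Schwarz_Pick_at_0:
  assumes h: "h holomorphic_on ball 0 1" and h_less: "\<And>z. cmod z < 1 \<Longrightarrow> cmod (h z) < 1"
  shows "cmod (deriv h 0) \<le> 1 - (cmod (h 0))\<^sup>2"
proof -
  define c where "c = h 0"
  define m where "m = Moebius_function 0 c \<circ> h"
  have c: "cmod c < 1"
    using h_less[of 0] by (simp add: c_def)
  have "m holomorphic_on ball 0 1"
    unfolding m_def using h_less
    by (intro holomorphic_on_compose_gen[OF h Moebius_function_holomorphic[OF c]]) auto
  moreover have "m 0 = 0"
    by (simp add: m_def c_def Moebius_function_eq_zero)
  moreover have "cmod (m z) < 1" if "cmod z < 1" for z
    using Moebius_function_norm_lt_1[OF c h_less[OF that]] by (simp add: m_def)
  ultimately have m': "cmod (deriv m 0) \<le> 1"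
    by (rule Schwarz_Lemma(2)[where \<xi> = 0]) auto
  have cc: "1 - cnj c * c = of_real (1 - (cmod c)\<^sup>2)"
    using complex_norm_square[of c] by (simp add: mult.commute)
  have pos: "0 < 1 - (cmod c)\<^sup>2"
    using c by (simp add: abs_square_less_1)
  have nz: "1 - cnj c * c \<noteq> 0"
    unfolding cc using pos by (simp only: of_real_eq_0_iff)
  have "(h has_field_derivative deriv h 0) (at 0)"
    using h by (intro holomorphic_derivI[of _ "ball 0 1"]) auto
  then have "((\<lambda>z. (h z - c) / (1 - cnj c * h z)) has_field_derivative
      (deriv h 0 * (1 - cnj c * c)) / (1 - cnj c * c)\<^sup>2) (at 0)"
    using nz by (auto intro!: derivative_eq_intros simp: c_def power2_eq_square)
  then have "deriv m 0 = deriv h 0 / (1 - cnj c * c)"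
    using nz by (intro DERIV_imp_deriv)
      (simp add: m_def o_def Moebius_function_simple power2_eq_square)
  then have "cmod (deriv m 0) = cmod (deriv h 0) / (1 - (cmod c)\<^sup>2)"
    unfolding cc using pos by (simp only: norm_divide norm_of_real abs_of_pos)
  then show ?thesis
    using m' pos by (simp add: c_def pos_divide_le_eq)
qed

lemma has_fps_expansion_eventually_eq:
  assumes "f has_fps_expansion A" and "eventually (\<lambda>z. f z = g z) (nhds 0)"
  shows "g has_fps_expansion A"
  using has_fps_expansion_cong[OF assms(2) refl] assms(1) by (rule iffD1)

text \<open>If \<open>\<omega>\<close> is a rotation, then \<open>\<omega>(z) / z\<close> is constant and the second coefficient vanishes. Otherwise
  \<open>\<omega>(z) / z\<close> is a self-map of the open disk by the strict form of Schwarz's lemma, and its value and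
  derivative at the origin are the first two coefficients of \<open>\<omega>\<close>.\<close>

lemma Schwarz_second_coefficient:
  assumes w: "w holomorphic_on ball 0 1" and w0: "w 0 = 0"
    and w_less: "\<And>z. cmod z < 1 \<Longrightarrow> cmod (w z) < 1"
    and W: "w has_fps_expansion W"
  shows "cmod (fps_nth W 1) \<le> 1" and "cmod (fps_nth W 2) \<le> 1 - (cmod (fps_nth W 1))\<^sup>2"
proof -
  obtain h where h: "h holomorphic_on ball 0 1"
    and w_eq: "\<And>z. cmod z < 1 \<Longrightarrow> w z = z * h z" and h0: "deriv w 0 = h 0"
    using Schwarz3[OF w w0] by metis
  have W1: "fps_nth W 1 = h 0"
    using fps_nth_fps_expansion[OF W, of 1] h0 by simp
  show le1: "cmod (fps_nth W 1) \<le> 1"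
    using Schwarz_Lemma(2)[OF w w0 w_less, of 0] unfolding W1 h0 by simp
  have H: "h has_fps_expansion fps_expansion h 0"
    using h by (intro has_fps_expansion_fps_expansion[of "ball 0 1"]) auto
  have "eventually (\<lambda>z. z \<in> ball 0 1) (nhds (0::complex))"
    by (intro eventually_nhds_in_open) auto
  then have "eventually (\<lambda>z. z * h z = w z) (nhds 0)"
    by eventually_elim (simp add: w_eq)
  then have "w has_fps_expansion fps_X * fps_expansion h 0"
    by (rule has_fps_expansion_eventually_eq[OF has_fps_expansion_mult[OF has_fps_expansion_fps_X H]])
  then have "W = fps_X * fps_expansion h 0"
    by (rule fps_expansion_unique_complex[OF W])
  then have W2: "fps_nth W 2 = deriv h 0"
    using fps_nth_fps_expansion[OF H, of 1] by simp
  show "cmod (fps_nth W 2) \<le> 1 - (cmod (fps_nth W 1))\<^sup>2"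
  proof (cases "(\<exists>z. cmod z < 1 \<and> z \<noteq> 0 \<and> cmod (w z) = cmod z) \<or> cmod (deriv w 0) = 1")
    case True
    then obtain a where a: "\<And>z. cmod z < 1 \<Longrightarrow> w z = a * z"
      using Schwarz_Lemma(3)[OF w w0 w_less, of 0] by auto
    have "eventually (\<lambda>z. z \<in> ball 0 1) (nhds (0::complex))"
      by (intro eventually_nhds_in_open) auto
    then have "eventually (\<lambda>z. a * z = w z) (nhds 0)"
      by eventually_elim (simp add: a)
    then have "w has_fps_expansion fps_const a * fps_X"
      by (rule has_fps_expansion_eventually_eq[OF
            has_fps_expansion_mult[OF has_fps_expansion_const has_fps_expansion_fps_X]])
    then have "W = fps_const a * fps_X"
      by (rule fps_expansion_unique_complex[OF W])
    then have "fps_nth W 2 = 0"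
      by simp
    then show ?thesis
      using le1 by (simp add: abs_square_le_1)
  next
    case False
    have "cmod (h z) < 1" if z: "cmod z < 1" for z
    proof (cases "z = 0")
      case True
      then show ?thesis
        using False le1 unfolding W1 h0 by simp
    next
      case nz: False
      then have "cmod (w z) < cmod z"
        using False z Schwarz_Lemma(1)[OF w w0 w_less z] by force
      then show ?thesis
        using nz by (simp add: w_eq[OF z] norm_mult)
    qed
    then show ?thesis
      unfolding W1 W2 by (rule Schwarz_Pick_at_0[OF h])
  qed
qed

lemma fps_right_inverse_nth_3:
  fixes P K :: "'a :: field fps"
  assumes eq: "P oo K = fps_X" and K0: "fps_nth K 0 = 0"
  shows "fps_nth P 1 \<noteq> 0"
    and "fps_nth K 3 = (2 * (fps_nth P 2)\<^sup>2 - fps_nth P 1 * fps_nth P 3) / fps_nth P 1 ^ 5"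
proof -
  define p q r where "p = fps_nth P 1" "q = fps_nth P 2" "r = fps_nth P 3"
  define k l m where "k = fps_nth K 1" "l = fps_nth K 2" "m = fps_nth K 3"
  note defs = p_q_r_def k_l_m_def
  note nth = fps_compose_nth fps_mult_nth numeral_2_eq_2 numeral_3_eq_3 K0 fps_X_def
  have e1: "p * k = 1"
    using arg_cong[OF eq, of "\<lambda>A. fps_nth A 1"] by (simp add: nth defs)
  have e2: "p * l + q * k\<^sup>2 = 0"
    using arg_cong[OF eq, of "\<lambda>A. fps_nth A 2"] by (simp add: nth defs)
  have e3: "p * m + 2 * q * k * l + r * k ^ 3 = 0"
    using arg_cong[OF eq, of "\<lambda>A. fps_nth A 3"] by (simp add: nth defs algebra_simps)
  show "fps_nth P 1 \<noteq> 0"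
    using e1 by (auto simp: defs)
  then have p: "p \<noteq> 0"
    by (simp add: defs)
  \<comment> \<open>The first two equations determine \<open>k = 1 / p\<close> and \<open>l = - q / p\<^sup>3\<close>; inserting this into the third
    and multiplying by \<open>p\<^sup>4\<close> gives the claim.\<close>
  have "p ^ 5 * m = 2 * q\<^sup>2 - p * r"
    using e1 e2 e3 by algebra
  then have "m = (2 * q\<^sup>2 - p * r) / p ^ 5"
    using p by (simp add: field_simps)
  then show "fps_nth K 3 = (2 * (fps_nth P 2)\<^sup>2 - fps_nth P 1 * fps_nth P 3) / fps_nth P 1 ^ 5"
    by (simp add: defs)
qed

text \<open>A series that starts with the linear term says nothing about \<open>a 0\<close>, which has to be reset to
  zero to obtain the formal power series of the function.\<close>

lemma has_fps_expansion_without_constant_term: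
  fixes f :: "complex \<Rightarrow> complex"
  assumes "eventually (\<lambda>z. (\<lambda>k. a (Suc k) * z ^ Suc k) sums f z) (nhds 0)"
  shows "f has_fps_expansion Abs_fps (a(0 := 0))"
proof (rule has_fps_expansionI)
  show "eventually (\<lambda>z. (\<lambda>n. fps_nth (Abs_fps (a(0 := 0))) n * z ^ n) sums f z) (nhds 0)"
    using assms
  proof eventually_elim
    case (elim z)
    then show ?case
      using sums_Suc_iff[of "\<lambda>n. fps_nth (Abs_fps (a(0 := 0))) n * z ^ n" "f z"] by simp
  qed
qed

theorem theorem4p3:
  fixes \<phi> \<psi> G :: "complex \<Rightarrow> complex"
    and \<alpha> \<beta> g :: "nat \<Rightarrow> complex"
    and b \<alpha>t \<beta>t :: complex
  assumes "\<phi> holomorphic_on ball 0 1"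
    and "\<And>z. z \<in> ball 0 1 \<Longrightarrow> (\<lambda>k. \<alpha> (Suc k) * z ^ Suc k) sums \<phi> z"
    and "\<psi> holomorphic_on ball 0 1"
    and "\<And>z. z \<in> ball 0 1 \<Longrightarrow> (\<lambda>k. \<beta> k * z ^ k) sums \<psi> z"
    and "\<alpha> 1 \<noteq> 0"
    and "\<beta> 0 \<noteq> 0"
    and "b = 1 / (\<alpha> 1 * \<beta> 0)"
    and "\<alpha>t = 2 * (\<alpha> 2)^2 - \<alpha> 1 * \<alpha> 3"
    and "\<beta>t = 2 * (\<beta> 1)^2 - \<beta> 0 * \<beta> 2"
    and "G \<in> class_B \<phi> \<psi>"
    and "\<forall>\<^sub>F z in nhds 0. (\<lambda>k. g (Suc k) * z ^ Suc k) sums G z"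
  shows "(\<beta> 1 \<noteq> 0 \<longrightarrow>
            (\<exists>\<gamma>\<^sub>1 \<in> cball 0 1.
               g 3 \<in> cball
                 (b^5 * ((\<beta> 0)^2 * \<alpha>t + 3 * \<alpha> 1 * \<beta> 0 * \<alpha> 2 * \<beta> 1 * \<gamma>\<^sub>1 + (\<alpha> 1)^2 * \<beta>t * \<gamma>\<^sub>1^2))
                 ((cmod b)^4 * cmod (\<alpha> 1 * \<beta> 1) * (1 - (cmod \<gamma>\<^sub>1)^2)))) \<and>
         (\<beta> 1 = 0 \<longrightarrow>
            g 3 \<in> cball (b^5 * (\<beta> 0)^2 * \<alpha>t) ((cmod b)^4 * cmod (\<alpha> 1 * \<beta> 2)))"
proof -
  obtain F where "F \<in> class_A \<phi> \<psi>" and inv: "local_inverse_at_0 F G"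
    using assms(10) unfolding class_B_def by blast
  then obtain w where w: "w holomorphic_on ball 0 1" "w ` ball 0 1 \<subseteq> ball 0 1" "w 0 = 0"
    and F: "\<forall>z\<in>ball 0 1. F z = \<phi> z * \<psi> (w z)"
    unfolding class_A_def by blast
  obtain V where V: "open V" "0 \<in> V" "\<forall>z\<in>V. F (G z) = z"
    using inv unfolding local_inverse_at_0_def by metis
  have disk: "eventually (\<lambda>z. z \<in> ball 0 1) (nhds (0::complex))"
    by (intro eventually_nhds_in_open) auto
  define P Q W K where "P = Abs_fps (\<alpha>(0 := 0))" "Q = Abs_fps \<beta>"
    "W = fps_expansion w 0" "K = Abs_fps (g(0 := 0))"
  note defs = P_Q_W_K_def
  have P: "\<phi> has_fps_expansion P"
    unfolding defs using disk assms(2)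
    by (intro has_fps_expansion_without_constant_term) (auto elim!: eventually_mono)
  have Q: "\<psi> has_fps_expansion Q"
    unfolding defs using disk assms(4)
    by (intro has_fps_expansionI) (auto elim!: eventually_mono)
  have W: "w has_fps_expansion W"
    unfolding defs using w by (intro has_fps_expansion_fps_expansion[of "ball 0 1"]) auto
  have K: "G has_fps_expansion K"
    unfolding defs using assms(11) by (rule has_fps_expansion_without_constant_term)
  have W0: "fps_nth W 0 = 0"
    using has_fps_expansion_imp_0_eq_fps_nth_0[OF W] w by simp
  have K0: "fps_nth K 0 = 0"
    by (simp add: defs)
  define R where "R = P * (Q oo W)"
  have "(\<lambda>z. \<phi> z * (\<psi> \<circ> w) z) has_fps_expansion R"
    unfolding R_def using P Q W W0
    by (intro has_fps_expansion_mult has_fps_expansion_compose)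
  moreover have "eventually (\<lambda>z. \<phi> z * (\<psi> \<circ> w) z = F z) (nhds 0)"
    using disk by eventually_elim (simp add: F)
  ultimately have "F has_fps_expansion R"
    by (rule has_fps_expansion_eventually_eq)
  then have "(F \<circ> G) has_fps_expansion (R oo K)"
    using K K0 by (rule has_fps_expansion_compose)
  moreover have "eventually (\<lambda>z. (F \<circ> G) z = z) (nhds 0)"
    using eventually_nhds_in_open[OF V(1,2)] by eventually_elim (simp add: V)
  ultimately have "(\<lambda>z. z) has_fps_expansion (R oo K)"
    by (rule has_fps_expansion_eventually_eq)
  then have RK: "R oo K = fps_X"
    using has_fps_expansion_fps_X by (rule fps_expansion_unique_complex)
  define c d where "c = fps_nth W 1" "d = fps_nth W 2"
  have c: "cmod c \<le> 1" and d: "cmod d \<le> 1 - (cmod c)\<^sup>2"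
    unfolding c_d_def using Schwarz_second_coefficient[OF w(1,3) _ W] w(2) by (auto simp: subset_iff)
  note nth = fps_compose_nth fps_mult_nth numeral_2_eq_2 numeral_3_eq_3 W0
  have R1: "fps_nth R 1 = \<alpha> 1 * \<beta> 0"
    by (simp add: R_def defs nth)
  have R2: "fps_nth R 2 = \<alpha> 2 * \<beta> 0 + \<alpha> 1 * \<beta> 1 * c"
    using W0 by (simp add: R_def defs(1,2) c_d_def nth algebra_simps)
  have R3: "fps_nth R 3 = \<alpha> 3 * \<beta> 0 + \<alpha> 2 * \<beta> 1 * c + \<alpha> 1 * (\<beta> 1 * d + \<beta> 2 * c\<^sup>2)"
    using W0 by (simp add: R_def defs(1,2) c_d_def nth algebra_simps)
  have b: "b * (\<alpha> 1 * \<beta> 0) = 1"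
    using assms(5-7) by simp
  have "g 3 = fps_nth K 3"
    by (simp add: defs)
  also have "\<dots> = b ^ 5 * (2 * (fps_nth R 2)\<^sup>2 - fps_nth R 1 * fps_nth R 3)"
    using fps_right_inverse_nth_3(2)[OF RK K0] unfolding R1 assms(7) by (simp add: power_divide)
  \<comment> \<open>One factor \<open>b\<close> stays attached to \<open>\<alpha> 1 * \<beta> 0\<close> in the last term: \<open>b * (\<alpha> 1 * \<beta> 0) = 1\<close> lowers
    the power of \<open>b\<close> from five to four, as in the radius of the disk.\<close>
  also have "\<dots> = b ^ 5 * ((\<beta> 0)\<^sup>2 * \<alpha>t + 3 * \<alpha> 1 * \<beta> 0 * \<alpha> 2 * \<beta> 1 * c + (\<alpha> 1)\<^sup>2 * \<beta>t * c\<^sup>2)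
      - b ^ 4 * (b * (\<alpha> 1 * \<beta> 0)) * (\<alpha> 1 * \<beta> 1) * d"
    unfolding R1 R2 R3 assms(8,9) by algebra
  finally have g3: "g 3 = b ^ 5 * ((\<beta> 0)\<^sup>2 * \<alpha>t + 3 * \<alpha> 1 * \<beta> 0 * \<alpha> 2 * \<beta> 1 * c + (\<alpha> 1)\<^sup>2 * \<beta>t * c\<^sup>2)
      - b ^ 4 * (\<alpha> 1 * \<beta> 1) * d"
    unfolding b by simp
  show ?thesis
  proof (intro conjI impI)
    have "cmod (b ^ 4 * (\<alpha> 1 * \<beta> 1) * d) \<le> (cmod b) ^ 4 * cmod (\<alpha> 1 * \<beta> 1) * (1 - (cmod c)\<^sup>2)"
      unfolding norm_mult norm_power using d by (intro mult_left_mono) auto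
    then show "\<exists>\<gamma>\<^sub>1\<in>cball 0 1. g 3 \<in> cball
        (b ^ 5 * ((\<beta> 0)\<^sup>2 * \<alpha>t + 3 * \<alpha> 1 * \<beta> 0 * \<alpha> 2 * \<beta> 1 * \<gamma>\<^sub>1 + (\<alpha> 1)\<^sup>2 * \<beta>t * \<gamma>\<^sub>1\<^sup>2))
        ((cmod b) ^ 4 * cmod (\<alpha> 1 * \<beta> 1) * (1 - (cmod \<gamma>\<^sub>1)\<^sup>2))"
      using c by (intro bexI[of _ c]) (simp_all add: g3 dist_norm)
  next
    assume \<beta>1: "\<beta> 1 = 0"
    have "b ^ 5 * (\<beta> 0)\<^sup>2 * \<alpha>t - g 3 = b ^ 4 * (b * (\<alpha> 1 * \<beta> 0)) * (\<alpha> 1 * \<beta> 2) * c\<^sup>2"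
      unfolding g3 assms(9) \<beta>1
      by (simp add: algebra_simps power2_eq_square power_numeral_reduce)
    then have diff: "b ^ 5 * (\<beta> 0)\<^sup>2 * \<alpha>t - g 3 = b ^ 4 * (\<alpha> 1 * \<beta> 2) * c\<^sup>2"
      unfolding b by simp
    have "cmod (b ^ 4 * (\<alpha> 1 * \<beta> 2) * c\<^sup>2) \<le> (cmod b) ^ 4 * cmod (\<alpha> 1 * \<beta> 2)"
      unfolding norm_mult norm_power using c
      by (intro mult_right_le_one_le mult_nonneg_nonneg power_le_one) auto
    then show "g 3 \<in> cball (b ^ 5 * (\<beta> 0)\<^sup>2 * \<alpha>t) ((cmod b) ^ 4 * cmod (\<alpha> 1 * \<beta> 2))"
      by (simp add: dist_norm diff)
  qed
qed

end
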